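(* Fix $\widetilde z\in\mathbb{R}^n$ and consider the problems $$\min_{w\in\mathbb{R}^p,\,u\in\mathbb{R}^n} f(w)+\lambda\|u_+\|_0\quad\text{s.t.}\quad Aw+b=u,\qquad(\mathrm{O})$$ $$\min_{(w;u;v)\in\mathbb{R}^p\times\mathbb{R}^n\times\mathbb{R}^p}\mathcal{V}_{\rho,\mu}(w,u,\widetilde z,v).\qquad(\mathrm{E})$$ Let $(\widehat w;\widehat u;\widehat v)$ be a $\widetilde{\rm P}$-stationary point of (E) with $\widetilde{\rm P}$-stationary multiplier $\widehat z$ and constant $\alpha>0$. Then: (i) $(\widehat w;\widehat u)$ is a P-stationary point of (O) with P-stationary multiplier $\widehat z$ and constant $\alpha>0$ if and only if $\widehat z=\widetilde z$. (ii) If $A$ is full row rank, then $\widehat z=-(AA^\top)^{-1}A\nabla f(\widehat w)$. Furthermore, $(\widehat w;\widehat u)$ is a P-stationary point of (O) with P-stationary multiplier $\widehat z$ and constant $\alpha>0$ if and only if $\widehat z=-(AA^\top)^{-1}A\nabla f(\widehat w)=\widetilde z$.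
   Context: Setting: $f:\mathbb{R}^p\to\mathbb{R}$ is smooth (continuously differentiable), $A\in\mathbb{R}^{n\times p}$, $b\in\mathbb{R}^n$, and $\lambda,\rho,\mu>0$. For $u\in\mathbb{R}^n$, $u_+:=(\max\{0,u_1\},\dots,\max\{0,u_n\})^\top$ and $\|u\|_0$ is the number of nonzero components of $u$. $(w;u)$ denotes concatenation. Lyapunov function: $\mathcal{V}_{\rho,\mu}(w,u,z,v):=f(w)+\lambda\|u_+\|_0+\langle z,Aw+b-u\rangle+\frac{\rho}{2}\|Aw+b-u\|^2+\frac{\mu}{2}\|w-v\|^2$. Proximal operator (set-valued): ${\rm Prox}_{\alpha\lambda\|(\cdot)_+\|_0}(z):=\arg\min_{u\in\mathbb{R}^n}\ \lambda\|u_+\|_0+\frac{1}{2\alpha}\|u-z\|^2$ for $\alpha>0$. $(w^*;u^* )$ is a P-stationary point of (O), with P-stationary multiplier $z^*\in\mathbb{R}^n$ and constant $\alpha>0$, if $$\nabla f(w^* )+A^\top z^*=0,\quad u^*\in{\rm Prox}_{\alpha\lambda\|(\cdot)_+\|_0}(u^*+\alpha z^* ),\quad Aw^*+b-u^*=0.$$ $(\widehat w;\widehat u;\widehat v)$ is a $\widetilde{\rm P}$-stationary point of (E), with $\widetilde{\rm P}$-stationary multiplier $\widehat z\in\mathbb{R}^n$ and constant $\alpha>0$, if $$\nabla f(\widehat w)+\mu(\widehat w-\widehat v)+A^\top\widehat z=0,\quad \widehat u\in{\rm Prox}_{\alpha\lambda\|(\cdot)_+\|_0}(\widehat u+\alpha\widehat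 z),\quad \widehat z=\widetilde z+\rho(A\widehat w+b-\widehat u),\quad \widehat v=\widehat w.$$ *)

theory Defs
  imports "HOL-Analysis.Analysis"
begin

text \<open>The gradient is meaningful only where \<open>f\<close> is differentiable; it is then the unique vector
  representing the Frechet derivative.\<close>

definition grad :: "('a::euclidean_space \<Rightarrow> real) \<Rightarrow> 'a \<Rightarrow> 'a" where
  "grad f x = (THE d. GDERIV f x :> d)"

definition cont_differentiable :: "('a::euclidean_space \<Rightarrow> real) \<Rightarrow> bool" where
  "cont_differentiable f \<longleftrightarrow> (\<forall>x. f differentiable (at x)) \<and> continuous_on UNIV (grad f)"

definition pos_vec :: "real^'n \<Rightarrow> real^'n" where
  "pos_vec u = (\<chi> i. max 0 (u $ i))"

definition l0 :: "real^'n \<Rightarrow> nat" where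
  "l0 u = card {i. u $ i \<noteq> 0}"

definition prox_pos_l0 :: "real \<Rightarrow> real \<Rightarrow> real^'n \<Rightarrow> (real^'n) set" where
  "prox_pos_l0 \<alpha> lam z =
     {u. is_arg_min (\<lambda>u. lam * real (l0 (pos_vec u)) + 1 / (2 * \<alpha>) * (norm (u - z))\<^sup>2) (\<lambda>_. True) u}"

text \<open>Problem (O) minimises \<open>objective_O f lam\<close> over \<open>feasible_O A b\<close>; problem (E) minimises
  \<open>\<lambda>(w, u, v). lyapunov f lam A b \<rho> \<mu> w u zt v\<close> over the whole space, for a fixed vector \<open>zt\<close>.
  Each problem is determined by its data, so the stationarity notions below take the data
  as arguments.\<close>

definition objective_O :: "(real^'p \<Rightarrow> real) \<Rightarrow> real \<Rightarrow> real^'p \<Rightarrow> real^'n \<Rightarrow> real" where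
  "objective_O f lam w u = f w + lam * real (l0 (pos_vec u))"

definition feasible_O :: "real^'p^'n \<Rightarrow> real^'n \<Rightarrow> ((real^'p) \<times> (real^'n)) set" where
  "feasible_O A b = {(w, u). A *v w + b = u}"

definition lyapunov ::
  "(real^'p \<Rightarrow> real) \<Rightarrow> real \<Rightarrow> real^'p^'n \<Rightarrow> real^'n \<Rightarrow> real \<Rightarrow> real
    \<Rightarrow> real^'p \<Rightarrow> real^'n \<Rightarrow> real^'n \<Rightarrow> real^'p \<Rightarrow> real" where
  "lyapunov f lam A b \<rho> \<mu> w u z v =
     f w + lam * real (l0 (pos_vec u)) + z \<bullet> (A *v w + b - u)
     + \<rho> / 2 * (norm (A *v w + b - u))\<^sup>2 + \<mu> / 2 * (norm (w - v))\<^sup>2"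

definition P_stationary_O ::
  "(real^'p \<Rightarrow> real) \<Rightarrow> real \<Rightarrow> real^'p^'n \<Rightarrow> real^'n
    \<Rightarrow> real^'p \<Rightarrow> real^'n \<Rightarrow> real^'n \<Rightarrow> real \<Rightarrow> bool" where
  "P_stationary_O f lam A b w u z \<alpha> \<longleftrightarrow>
     \<alpha> > 0 \<and>
     grad f w + transpose A *v z = 0 \<and>
     u \<in> prox_pos_l0 \<alpha> lam (u + \<alpha> *\<^sub>R z) \<and>
     A *v w + b - u = 0"

definition P_tilde_stationary_E ::
  "(real^'p \<Rightarrow> real) \<Rightarrow> real \<Rightarrow> real^'p^'n \<Rightarrow> real^'n \<Rightarrow> real \<Rightarrow> real \<Rightarrow> real^'n
    \<Rightarrow> real^'p \<Rightarrow> real^'n \<Rightarrow> real^'p \<Rightarrow> real^'n \<Rightarrow> real \<Rightarrow> bool" where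
  "P_tilde_stationary_E f lam A b \<rho> \<mu> zt w u v z \<alpha> \<longleftrightarrow>
     \<alpha> > 0 \<and>
     grad f w + \<mu> *\<^sub>R (w - v) + transpose A *v z = 0 \<and>
     u \<in> prox_pos_l0 \<alpha> lam (u + \<alpha> *\<^sub>R z) \<and>
     z = zt + \<rho> *\<^sub>R (A *v w + b - u) \<and>
     v = w"

end

theory Submission
  imports Defs
begin

text \<open>Since \<open>vh = wh\<close>, the proximal term drops out of the gradient equation, so a P-tilde
  stationary point of (E) already meets the gradient and prox conditions of P-stationarity for
  (O) with the multiplier \<open>zh\<close>. What remains is feasibility, and because
  \<open>zh - zt = \<rho> (A wh + b - uh)\<close> with \<open>\<rho> \<noteq> 0\<close>, the residual vanishes precisely when the two
  multipliers agree. For the closed formula, applying \<open>A\<close> to \<open>\<nabla>f(wh) = - A\<^sup>T zh\<close> gives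
  \<open>(A A\<^sup>T) zh = - A \<nabla>f(wh)\<close>, which determines \<open>zh\<close> because the Gram matrix \<open>A A\<^sup>T\<close> of
  linearly independent rows is invertible (\<open>invertible_gram_of_full_row_rank\<close>).\<close>

text \<open>From \<open>A A\<^sup>T x = 0\<close> it follows that \<open>\<parallel>A\<^sup>T x\<parallel>\<^sup>2 = x \<bullet> A A\<^sup>T x = 0\<close>, so the Gram matrix has
  the same kernel as \<open>A\<^sup>T\<close>, which is trivial when the rows of \<open>A\<close> are independent.\<close>

lemma invertible_gram_of_full_row_rank:
  fixes A :: "real^'p^'n"
  assumes "rank A = CARD('n)"
  shows "invertible (A ** transpose A)"
proof -
  have inj: "inj ((*v) (transpose A))"
    using assms by (simp add: rank_transpose flip: full_rank_injective)
  have "x = 0" if "(A ** transpose A) *v x = 0" for x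
  proof -
    have "(transpose A *v x) \<bullet> (transpose A *v x) = x \<bullet> ((A ** transpose A) *v x)"
      by (simp add: dot_lmul_matrix flip: matrix_vector_mul_assoc)
    then have "transpose A *v x = transpose A *v 0"
      using that by simp
    with inj show "x = 0"
      by (rule injD)
  qed
  then show ?thesis
    by (auto simp: invertible_left_inverse matrix_left_invertible_ker)
qed

lemma multiplier_eq_of_full_row_rank:
  fixes A :: "real^'p^'n"
  assumes "rank A = CARD('n)" and "g + transpose A *v z = 0"
  shows "z = - (matrix_inv (A ** transpose A) *v (A *v g))"
proof -
  have "A *v g = - ((A ** transpose A) *v z)"
    using assms(2) by (simp add: eq_neg_iff_add_eq_0 flip: matrix_vector_mul_assoc
        matrix_vector_right_distrib)
  moreover have "matrix_inv (A ** transpose A) ** (A ** transpose A) = mat 1"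
    using invertible_gram_of_full_row_rank[OF assms(1)]
    unfolding invertible_def matrix_inv_def by (rule someI2_ex) simp
  ultimately show ?thesis
    by (simp add: vec.neg matrix_vector_mul_assoc)
qed

theorem theorem3:
  fixes f :: "real^'p \<Rightarrow> real" and A :: "real^'p^'n" and b :: "real^'n"
    and lam \<rho> \<mu> \<alpha> :: real
    and zt zh uh :: "real^'n" and wh vh :: "real^'p"
  assumes "cont_differentiable f" and "lam > 0" and "\<rho> > 0" and "\<mu> > 0" and "\<alpha> > 0"
    and "P_tilde_stationary_E f lam A b \<rho> \<mu> zt wh uh vh zh \<alpha>"
  shows "(P_stationary_O f lam A b wh uh zh \<alpha> \<longleftrightarrow> zh = zt)
    \<and> (rank A = CARD('n) \<longrightarrow>
         zh = - (matrix_inv (A ** transpose A) *v (A *v grad f wh))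
         \<and> (P_stationary_O f lam A b wh uh zh \<alpha> \<longleftrightarrow>
              zh = - (matrix_inv (A ** transpose A) *v (A *v grad f wh))
              \<and> - (matrix_inv (A ** transpose A) *v (A *v grad f wh)) = zt))"
proof -
  have grad_eq: "grad f wh + transpose A *v zh = 0"
    and prox: "uh \<in> prox_pos_l0 \<alpha> lam (uh + \<alpha> *\<^sub>R zh)"
    and zh: "zh = zt + \<rho> *\<^sub>R (A *v wh + b - uh)"
    using assms(6) by (auto simp: P_tilde_stationary_E_def)
  have "A *v wh + b - uh = 0 \<longleftrightarrow> zh = zt"
    using \<open>\<rho> > 0\<close> by (subst zh) simp
  then have iff: "P_stationary_O f lam A b wh uh zh \<alpha> \<longleftrightarrow> zh = zt"
    using grad_eq prox \<open>\<alpha> > 0\<close> by (simp add: P_stationary_O_def)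
  show ?thesis
    using iff multiplier_eq_of_full_row_rank[OF _ grad_eq] by metis
qed

end
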